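(* Assume that $T$ is continuous on $C$, that $S_*\neq\varnothing$ and that $S_*\subseteq S_{\rm dual}$. Let $(x^k)_{k\in\mathbb{N}}$ be an infinite sequence generated by Conceptual Algorithm B with Variant B.2, that is, $x^{k+1}=P_{C\cap H(z^k,\bar v^k)}(x^k)$, such that $x^k\notin S_*$ for all $k\in\mathbb{N}$. Then $(x^k)_{k\in\mathbb{N}}$ converges to a point in $S_*$.
   Context: $\mathbb{R}^n$ carries the Euclidean inner product $\langle\cdot,\cdot\rangle$ and norm $\|\cdot\|$; $\mathbb{N}=\{0,1,2,\dots\}$. $T:\operatorname{dom}(T)\subseteq\mathbb{R}^n\to\mathbb{R}^n$ is an operator and $C\subseteq\operatorname{dom}(T)$ is nonempty, closed and convex. $P_S$ is the orthogonal projection onto a nonempty closed convex set $S$. For $x\in C$, $\mathcal{N}_C(x)=\{u\in\mathbb{R}^n:\langle u,y-x\rangle\le 0\ \forall y\in C\}$. $S_*=\{x_*\in C:\langle T(x_* ),x-x_*\rangle\ge0\ \forall x\in C\}$ and $S_{\rm dual}=\{x_*\in C:\langle T(x),x-x_*\rangle\ge0\ \forall x\in C\}$. For $z\in C$ and $v\in\mathcal{N}_C(z)$, $H(z,v)=\{y\in\mathbb{R}^n:\langle T(z)+v,y-z\rangle\le0\}$. Conceptual Algorithm B. Fix $\sigma>0$, $\delta,\theta\in(0,1)$, $M>0$. Linesearch B, for input $x\in C$, $u\in\mathcal{N}_C(x)$: start with $\alpha=\sigma$. For each trial $\alpha$ let $z_\alpha=P_C(x-\alpha(T(x)+\alpha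 u))$ and choose any $v_\alpha\in\mathcal{N}_C(z_\alpha)$ with $\|v_\alpha\|\le M$. While $\alpha\|T(z_\alpha)-T(x)+\alpha v_\alpha-\alpha u\|>\delta\|z_\alpha-x\|$, replace $\alpha$ by $\theta\alpha$ (and choose a new such $v_\alpha$). Output $(\alpha,z_\alpha,v_\alpha)$. Algorithm: take $x^0\in C$. At iteration $k$, stop if $x^k=P_C(x^k-T(x^k))$. Otherwise choose any $u^k\in\mathcal{N}_C(x^k)$ with $\|u^k\|\le M$, let $(\alpha_k,z^k,v^k)$ be the output of Linesearch B for input $(x^k,u^k)$, set $\bar v^k=\alpha_kv^k$, and compute $x^{k+1}$ by the update rule of the chosen variant. *)

theory Defs
  imports "HOL-Analysis.Analysis"
begin

text \<open>
  The operator is a total function \<open>T\<close>; all the notions below evaluate it only at points of the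
  closed convex set \<open>C\<close>, so its values outside \<open>C\<close> are irrelevant and a partial operator whose
  domain includes \<open>C\<close> may be extended arbitrarily. The orthogonal projection onto \<open>S\<close> is the
  library's \<^const>\<open>closest_point\<close>.
\<close>

definition normal_cone :: "'a::euclidean_space set \<Rightarrow> 'a \<Rightarrow> 'a set"
  where "normal_cone C x = {u. \<forall>y\<in>C. inner u (y - x) \<le> 0}"

definition primal_sols :: "('a::euclidean_space \<Rightarrow> 'a) \<Rightarrow> 'a set \<Rightarrow> 'a set"
  where "primal_sols T C = {s\<in>C. \<forall>x\<in>C. inner (T s) (x - s) \<ge> 0}"

definition dual_sols :: "('a::euclidean_space \<Rightarrow> 'a) \<Rightarrow> 'a set \<Rightarrow> 'a set"
  where "dual_sols T C = {s\<in>C. \<forall>x\<in>C. inner (T x) (x - s) \<ge> 0}"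

text \<open>\<open>halfspace T z v\<close> is all of the space when \<open>T z + v = 0\<close>.\<close>

definition halfspace :: "('a::euclidean_space \<Rightarrow> 'a) \<Rightarrow> 'a \<Rightarrow> 'a \<Rightarrow> 'a set"
  where "halfspace T z v = {y. inner (T z + v) (y - z) \<le> 0}"

definition trial_point :: "('a::euclidean_space \<Rightarrow> 'a) \<Rightarrow> 'a set \<Rightarrow> 'a \<Rightarrow> 'a \<Rightarrow> real \<Rightarrow> 'a"
  where "trial_point T C x u \<alpha> = closest_point C (x - \<alpha> *\<^sub>R (T x + \<alpha> *\<^sub>R u))"

text \<open>
  \<open>linesearch_loop T C \<delta> \<theta> M x u \<alpha> (\<beta>, z, v)\<close>: the backtracking loop, entered with trial step
  \<open>\<alpha>\<close>, can terminate with output \<open>(\<beta>, z, v)\<close>. The vectors \<open>v\<close> are chosen afresh and arbitrarily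
  at each trial, so the loop is a relation rather than a function.
\<close>

inductive linesearch_loop ::
  "('a::euclidean_space \<Rightarrow> 'a) \<Rightarrow> 'a set \<Rightarrow> real \<Rightarrow> real \<Rightarrow> real \<Rightarrow> 'a \<Rightarrow> 'a \<Rightarrow>
    real \<Rightarrow> real \<times> 'a \<times> 'a \<Rightarrow> bool"
  for T C \<delta> \<theta> M x u
where
  accept:
    "\<lbrakk> z = trial_point T C x u \<alpha>; v \<in> normal_cone C z; norm v \<le> M;
       \<alpha> * norm (T z - T x + \<alpha> *\<^sub>R v - \<alpha> *\<^sub>R u) \<le> \<delta> * norm (z - x) \<rbrakk>
     \<Longrightarrow> linesearch_loop T C \<delta> \<theta> M x u \<alpha> (\<alpha>, z, v)"
| backtrack:
    "\<lbrakk> z = trial_point T C x u \<alpha>; v \<in> normal_cone C z; norm v \<le> M;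
       \<alpha> * norm (T z - T x + \<alpha> *\<^sub>R v - \<alpha> *\<^sub>R u) > \<delta> * norm (z - x);
       linesearch_loop T C \<delta> \<theta> M x u (\<theta> * \<alpha>) out \<rbrakk>
     \<Longrightarrow> linesearch_loop T C \<delta> \<theta> M x u \<alpha> out"

definition linesearch_B ::
  "('a::euclidean_space \<Rightarrow> 'a) \<Rightarrow> 'a set \<Rightarrow> real \<Rightarrow> real \<Rightarrow> real \<Rightarrow> real \<Rightarrow> 'a \<Rightarrow> 'a \<Rightarrow>
    real \<times> 'a \<times> 'a \<Rightarrow> bool"
  where "linesearch_B T C \<sigma> \<delta> \<theta> M x u out \<longleftrightarrow> linesearch_loop T C \<delta> \<theta> M x u \<sigma> out"

text \<open>
  One iteration from \<open>x\<close> to \<open>x'\<close>. The first conjunct says that the stopping test fails at \<open>x\<close>, so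
  that a next iterate is actually computed.
\<close>

definition step_B2 ::
  "('a::euclidean_space \<Rightarrow> 'a) \<Rightarrow> 'a set \<Rightarrow> real \<Rightarrow> real \<Rightarrow> real \<Rightarrow> real \<Rightarrow> 'a \<Rightarrow> 'a \<Rightarrow> bool"
  where "step_B2 T C \<sigma> \<delta> \<theta> M x x' \<longleftrightarrow>
    x \<noteq> closest_point C (x - T x) \<and>
    (\<exists>u \<alpha> z v. u \<in> normal_cone C x \<and> norm u \<le> M \<and>
       linesearch_B T C \<sigma> \<delta> \<theta> M x u (\<alpha>, z, v) \<and>
       x' = closest_point (C \<inter> halfspace T z (\<alpha> *\<^sub>R v)) x)"

definition generated_by_B2 ::
  "('a::euclidean_space \<Rightarrow> 'a) \<Rightarrow> 'a set \<Rightarrow> real \<Rightarrow> real \<Rightarrow> real \<Rightarrow> real \<Rightarrow> (nat \<Rightarrow> 'a) \<Rightarrow> bool"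
  where "generated_by_B2 T C \<sigma> \<delta> \<theta> M x \<longleftrightarrow>
    x 0 \<in> C \<and> (\<forall>k. step_B2 T C \<sigma> \<delta> \<theta> M (x k) (x (Suc k)))"

end

theory Submission
  imports Defs
begin

text \<open>
  Every half-space \<open>H(z\<^sup>k, \<alpha>\<^sub>k v\<^sup>k)\<close> contains \<open>S\<^sub>*\<close>, because \<open>S\<^sub>* \<subseteq> S\<^sub>d\<^sub>u\<^sub>a\<^sub>l\<close>; hence the iterates are
  Fejer monotone with respect to \<open>S\<^sub>*\<close> and \<open>x\<^sup>k\<^sup>+\<^sup>1 - x\<^sup>k \<rightarrow> 0\<close>. The acceptance test of the linesearch
  makes the half-space separate \<open>x\<^sup>k\<close> with a margin of order \<open>\<parallel>x\<^sup>k - z\<^sup>k\<parallel>\<^sup>2 / \<alpha>\<^sub>k\<close>, so \<open>x\<^sup>k - z\<^sup>k \<rightarrow> 0\<close>.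
  Consequently for large \<open>k\<close> some trial step \<open>\<beta>\<close> has a small residual \<open>\<parallel>x\<^sup>k - z\<^sub>\<beta>\<parallel> / \<beta>\<close>: if \<open>\<alpha>\<^sub>k\<close> is
  bounded below, take \<open>\<beta> = \<alpha>\<^sub>k\<close>; if \<open>\<alpha>\<^sub>k\<close> is small, take the last rejected step \<open>\<beta> = \<alpha>\<^sub>k / \<theta>\<close>, whose
  rejection bounds the residual by the oscillation of \<open>T\<close>. A small residual gives
  \<open>\<langle>T(x\<^sup>k), y - x\<^sup>k\<rangle> \<ge> -\<epsilon>\<close> for every \<open>y \<in> C\<close>, so every cluster point lies in \<open>S\<^sub>*\<close>, and Fejer
  monotonicity turns this into convergence.
\<close>

section \<open>Fejer convergence and the record left by the linesearch\<close>

text \<open>Decreasing distances to one point of \<open>S\<close> bound the sequence, so a cluster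
  point \<open>l\<close> exists and lies in \<open>S\<close>. The distance to \<open>l\<close>
  itself is then decreasing and tends to 0 along a subsequence, hence along the whole
  sequence.\<close>

lemma Fejer_monotone_LIMSEQ:
  fixes x :: "nat \<Rightarrow> 'a::heine_borel"
  assumes "S \<noteq> {}"
    and mono: "\<And>s k. s \<in> S \<Longrightarrow> dist (x (Suc k)) s \<le> dist (x k) s"
    and cluster: "\<And>r l. strict_mono r \<Longrightarrow> (x \<circ> r) \<longlonglongrightarrow> l \<Longrightarrow> l \<in> S"
  shows "\<exists>s\<in>S. x \<longlonglongrightarrow> s"
proof -
  obtain s where s: "s \<in> S" using assms(1) by blast
  have dec: "decseq (\<lambda>k. dist (x k) t)" if "t \<in> S" for t
    using mono[OF that] by (simp add: decseq_SucI)
  have "range x \<subseteq> cball s (dist (x 0) s)"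
    using decseqD[OF dec[OF s], of 0] by (auto simp: dist_commute)
  then have "bounded (range x)"
    using bounded_cball bounded_subset by blast
  then obtain l r where r: "strict_mono (r :: nat \<Rightarrow> nat)" "(x \<circ> r) \<longlonglongrightarrow> l"
    using bounded_imp_convergent_subsequence by blast
  then have l: "l \<in> S" by (rule cluster)
  have "x \<longlonglongrightarrow> l"
  proof (rule metric_LIMSEQ_I)
    fix e :: real assume "0 < e"
    then obtain m where "dist ((x \<circ> r) m) l < e"
      using metric_LIMSEQ_D[OF r(2)] by blast
    then show "\<exists>N. \<forall>n\<ge>N. dist (x n) l < e"
      using decseqD[OF dec[OF l], of "r m"] by (intro exI[of _ "r m"]) fastforce
  qed
  with l show ?thesis by blast
qed

text \<open>Besides the acceptance test, the last disjunct keeps the trial rejected just before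
  acceptance, whose failed test later controls the residual when \<open>\<beta>\<close> is
  small.\<close>

lemma linesearch_loop_output:
  assumes "linesearch_loop T C \<delta> \<theta> M x u \<alpha> out" "0 < \<alpha>" "0 < \<theta>" "\<theta> < 1" "out = (\<beta>, z, v)"
  shows "0 < \<beta> \<and> \<beta> \<le> \<alpha> \<and> z = trial_point T C x u \<beta> \<and> v \<in> normal_cone C z \<and> norm v \<le> M \<and>
    \<beta> * norm (T z - T x + \<beta> *\<^sub>R v - \<beta> *\<^sub>R u) \<le> \<delta> * norm (z - x) \<and>
    (\<beta> = \<alpha> \<or> (\<exists>\<gamma> w v'. \<beta> = \<theta> * \<gamma> \<and> \<gamma> \<le> \<alpha> \<and> w = trial_point T C x u \<gamma> \<and> norm v' \<le> M \<and>
       \<delta> * norm (w - x) < \<gamma> * norm (T w - T x + \<gamma> *\<^sub>R v' - \<gamma> *\<^sub>R u)))"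
  using assms
proof (induction rule: linesearch_loop.induct)
  case (accept z' \<alpha> v')
  then show ?case by auto
next
  case (backtrack z' \<alpha> v' out)
  have le: "\<theta> * \<alpha> \<le> \<alpha>" and "0 < \<theta> * \<alpha>"
    using backtrack.prems by (auto simp: mult_le_cancel_right1)
  note IH = backtrack.IH[OF this(2) backtrack.prems(2-4)]
  have "\<exists>\<gamma> w v'. \<beta> = \<theta> * \<gamma> \<and> \<gamma> \<le> \<alpha> \<and> w = trial_point T C x u \<gamma> \<and> norm v' \<le> M \<and>
       \<delta> * norm (w - x) < \<gamma> * norm (T w - T x + \<gamma> *\<^sub>R v' - \<gamma> *\<^sub>R u)"
  \<comment> \<open>In the first case the trial rejected here is the witness; otherwise the
    induction hypothesis supplies a later one.\<close>
  proof (cases "\<beta> = \<theta> * \<alpha>")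
    case True
    with backtrack.hyps show ?thesis by blast
  next
    case False
    with IH obtain \<gamma> w v' where "\<beta> = \<theta> * \<gamma>" "\<gamma> \<le> \<theta> * \<alpha>" "w = trial_point T C x u \<gamma>"
      "norm v' \<le> M" "\<delta> * norm (w - x) < \<gamma> * norm (T w - T x + \<gamma> *\<^sub>R v' - \<gamma> *\<^sub>R u)"
      by blast
    moreover have "\<gamma> \<le> \<alpha>" using calculation le by linarith
    ultimately show ?thesis by blast
  qed
  moreover have "\<beta> \<le> \<alpha>"
    using IH le by linarith
  ultimately show ?case
    using IH by blast
qed

section \<open>Inequalities for projections and trial points\<close>

context
  fixes C :: "'a::euclidean_space set"
  assumes closed: "closed C" and convex: "convex C"
begin

lemma trial_point_in: "x \<in> C \<Longrightarrow> trial_point T C x u \<alpha> \<in> C"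
  unfolding trial_point_def using closed closest_point_in_set by blast

text \<open>The obtuse-angle property of the projection, rearranged. It is used with
  \<open>y = x\<close> to bound or separate, and with arbitrary \<open>y\<close> to approximate the
  variational inequality.\<close>

lemma trial_point_inner_le:
  assumes "y \<in> C" and z: "z = trial_point T C x u \<alpha>"
  shows "inner (x - z) (y - z) \<le> \<alpha> * inner (T x + \<alpha> *\<^sub>R u) (y - z)"
proof -
  have "inner (x - \<alpha> *\<^sub>R (T x + \<alpha> *\<^sub>R u) - z) (y - z) \<le> 0"
    unfolding z trial_point_def by (rule closest_point_dot[OF convex closed assms(1)])
  moreover have "x - \<alpha> *\<^sub>R (T x + \<alpha> *\<^sub>R u) - z = (x - z) - \<alpha> *\<^sub>R (T x + \<alpha> *\<^sub>R u)"
    by simp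
  ultimately show ?thesis
    by (simp only: inner_diff_left inner_scaleR_left)
qed

lemma norm_diff_trial_point_le:
  assumes "x \<in> C" "0 \<le> \<alpha>"
  shows "norm (x - trial_point T C x u \<alpha>) \<le> \<alpha> * norm (T x + \<alpha> *\<^sub>R u)"
proof -
  let ?d = "x - trial_point T C x u \<alpha>"
  have "norm ?d * norm ?d \<le> \<alpha> * inner (T x + \<alpha> *\<^sub>R u) ?d"
    using trial_point_inner_le[OF assms(1) refl, of x T u \<alpha>]
    by (simp add: dot_square_norm power2_eq_square)
  also have "\<dots> \<le> \<alpha> * (norm (T x + \<alpha> *\<^sub>R u) * norm ?d)"
    using assms(2) norm_cauchy_schwarz by (intro mult_left_mono)
  finally show ?thesis
    using assms(2) by (cases "?d = 0") (auto simp: mult.assoc[symmetric])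
qed

text \<open>Dividing the projection inequality by \<open>\<alpha>\<close> leaves the residual as an
  error \<open>\<epsilon>\<close>. Moving the base point from \<open>z\<close> to \<open>x\<close>
  costs the second error term, and the cone term \<open>inner u (y - x)\<close> has the favourable
  sign.\<close>

lemma inner_ge_of_residual:
  assumes "y \<in> C" and z: "z = trial_point T C x u \<alpha>" and "0 < \<alpha>"
    and u: "u \<in> normal_cone C x" "norm u \<le> M"
    and small: "norm (x - z) \<le> \<epsilon> * \<alpha>"
  shows "- \<epsilon> * norm (y - z) - (norm (T x) + \<alpha> * M) * norm (x - z) \<le> inner (T x) (y - x)"
proof -
  have 1: "\<alpha> * (- \<epsilon> * norm (y - z)) \<le> inner (x - z) (y - z)"
  proof -
    have "- inner (x - z) (y - z) \<le> norm (x - z) * norm (y - z)"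
      using Cauchy_Schwarz_ineq2[of "x - z" "y - z"] by linarith
    also have "\<dots> \<le> \<epsilon> * \<alpha> * norm (y - z)"
      using small by (intro mult_right_mono) auto
    finally show ?thesis by (simp add: mult_ac)
  qed
  have "- \<epsilon> * norm (y - z) \<le> inner (T x + \<alpha> *\<^sub>R u) (y - z)"
    using 1 trial_point_inner_le[OF assms(1) z] \<open>0 < \<alpha>\<close>
    by (meson mult_le_cancel_left_pos order_trans)
  also have "\<dots> = inner (T x) (y - x) + inner (T x) (x - z) + \<alpha> * inner u (y - x) + \<alpha> * inner u (x - z)"
    by (simp add: algebra_simps)
  also have "\<dots> \<le> inner (T x) (y - x) + norm (T x) * norm (x - z) + \<alpha> * 0 + \<alpha> * (M * norm (x - z))"
  proof (intro add_mono mult_left_mono order_refl norm_cauchy_schwarz)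
    show "inner u (y - x) \<le> 0"
      using u \<open>y \<in> C\<close> by (simp add: normal_cone_def)
    show "inner u (x - z) \<le> M * norm (x - z)"
      using norm_cauchy_schwarz[of u "x - z"] mult_right_mono[OF u(2), of "norm (x - z)"] by simp
  qed (use \<open>0 < \<alpha>\<close> in auto)
  finally show ?thesis by (simp add: algebra_simps)
qed

text \<open>With \<open>T x + \<alpha> *\<^sub>R u\<close> in place of
  \<open>T z + \<alpha> *\<^sub>R v\<close>, the projection inequality gives the full square of
  \<open>norm (x - z)\<close>; the acceptance test limits the loss from the replacement to a
  fraction \<open>\<delta>\<close>.\<close>

lemma accepted_step_separates:
  assumes "x \<in> C" and z: "z = trial_point T C x u \<alpha>" and "0 < \<alpha>"
    and acc: "\<alpha> * norm (T z - T x + \<alpha> *\<^sub>R v - \<alpha> *\<^sub>R u) \<le> \<delta> * norm (z - x)"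
  shows "(1 - \<delta>) * (norm (x - z))\<^sup>2 \<le> \<alpha> * inner (T z + \<alpha> *\<^sub>R v) (x - z)"
proof -
  let ?e = "T z - T x + \<alpha> *\<^sub>R v - \<alpha> *\<^sub>R u"
  have "- (\<alpha> * inner ?e (x - z)) \<le> \<alpha> * (norm ?e * norm (x - z))"
    using Cauchy_Schwarz_ineq2[of ?e "x - z"] \<open>0 < \<alpha>\<close>
    by (metis abs_le_D2 mult_le_cancel_left_pos mult_minus_right)
  also have "\<dots> \<le> \<delta> * (norm (x - z))\<^sup>2"
    using mult_right_mono[OF acc, of "norm (x - z)"]
    by (simp add: norm_minus_commute power2_eq_square mult_ac)
  finally have "- (\<alpha> * inner ?e (x - z)) \<le> \<delta> * (norm (x - z))\<^sup>2" .
  moreover have "(norm (x - z))\<^sup>2 \<le> \<alpha> * inner (T x + \<alpha> *\<^sub>R u) (x - z)"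
    using trial_point_inner_le[OF assms(1) z] by (simp add: dot_square_norm)
  moreover have "\<alpha> * inner (T z + \<alpha> *\<^sub>R v) (x - z)
      = \<alpha> * inner (T x + \<alpha> *\<^sub>R u) (x - z) + \<alpha> * inner ?e (x - z)"
    by (simp add: algebra_simps)
  ultimately show ?thesis by (simp add: algebra_simps)
qed

text \<open>Expand the square of \<open>x - s = (x - p) - (s - p)\<close>; the cross term has a sign
  by the obtuse angle at \<open>p\<close>.\<close>

lemma closest_point_Fejer:
  assumes "s \<in> C"
  shows "(norm (closest_point C x - x))\<^sup>2 \<le> (norm (x - s))\<^sup>2 - (norm (closest_point C x - s))\<^sup>2"
proof -
  define p where "p = closest_point C x"
  have "inner (x - p) (s - p) \<le> 0"
    unfolding p_def by (rule closest_point_dot[OF convex closed assms])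
  then show ?thesis unfolding p_def[symmetric]
    by (simp add: power2_norm_eq_inner algebra_simps inner_commute)
qed

end

section \<open>Half-spaces, cluster points and small residuals\<close>

lemma closed_halfspace: "closed (halfspace T z v)"
proof -
  have "halfspace T z v = {y. inner (T z + v) y \<le> inner (T z + v) z}"
    by (auto simp: halfspace_def inner_diff_right)
  then show ?thesis by (simp add: closed_halfspace_le)
qed

lemma convex_halfspace: "convex (halfspace T z v)"
proof -
  have "halfspace T z v = {y. inner (T z + v) y \<le> inner (T z + v) z}"
    by (auto simp: halfspace_def inner_diff_right)
  then show ?thesis by (simp add: convex_halfspace_le)
qed

lemma dual_sols_in_halfspace:
  assumes "s \<in> dual_sols T C" "z \<in> C" "v \<in> normal_cone C z" "0 \<le> \<alpha>"
  shows "s \<in> halfspace T z (\<alpha> *\<^sub>R v)"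
proof -
  have "inner (T z) (z - s) \<ge> 0" "inner v (s - z) \<le> 0"
    using assms by (auto simp: dual_sols_def normal_cone_def)
  moreover have "\<alpha> * inner v (s - z) \<le> 0"
    using assms(4) calculation(2) by (simp add: mult_nonneg_nonpos)
  ultimately show ?thesis by (simp add: halfspace_def algebra_simps)
qed

text \<open>For fixed \<open>y\<close> the asymptotic inequality passes to the limit by continuity
  of \<open>T\<close>, and then \<open>\<epsilon>\<close> is arbitrary.\<close>

lemma cluster_point_primal_sol:
  fixes x :: "nat \<Rightarrow> 'a::euclidean_space"
  assumes "closed C" "continuous_on C T" "\<And>k. x k \<in> C"
    and asym: "\<And>y \<epsilon>. y \<in> C \<Longrightarrow> 0 < \<epsilon> \<Longrightarrow> \<forall>\<^sub>F k in sequentially. - \<epsilon> \<le> inner (T (x k)) (y - x k)"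
    and r: "strict_mono r" "(x \<circ> r) \<longlonglongrightarrow> l"
  shows "l \<in> primal_sols T C"
proof -
  have l: "l \<in> C"
    using closed_sequentially[OF assms(1) _ r(2)] assms(3) by auto
  have "(\<lambda>k. T (x (r k))) \<longlonglongrightarrow> T l"
    using continuous_on_tendsto_compose[OF assms(2) r(2) l] assms(3) by auto
  then have lim: "(\<lambda>k. inner (T (x (r k))) (y - x (r k))) \<longlonglongrightarrow> inner (T l) (y - l)" for y
    using r(2) by (auto intro!: tendsto_intros simp: o_def)
  have "0 \<le> inner (T l) (y - l)" if "y \<in> C" for y
  proof (rule field_le_epsilon)
    fix \<epsilon> :: real assume "0 < \<epsilon>"
    have "\<forall>\<^sub>F k in sequentially. - \<epsilon> \<le> inner (T (x (r k))) (y - x (r k))"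
      using eventually_subseq[OF r(1) asym[OF that \<open>0 < \<epsilon>\<close>]] .
    then have "- \<epsilon> \<le> inner (T l) (y - l)"
      using tendsto_lowerbound[OF lim] by simp
    then show "0 \<le> inner (T l) (y - l) + \<epsilon>" by simp
  qed
  with l show ?thesis by (simp add: primal_sols_def)
qed

text \<open>The threshold \<open>c\<close> separates long accepted steps from short ones. Limiting
  \<open>osc\<close> to points within \<open>\<sigma> * L\<close> of \<open>x\<close> lets one
  \<open>\<eta>\<close>, taken from uniform continuity on a compact set, serve all iterates.\<close>

lemma linesearch_small_residual:
  fixes C :: "'a::euclidean_space set"
  assumes C: "closed C" "convex C" and x: "x \<in> C" and u: "norm u \<le> M"
    and ls: "linesearch_loop T C \<delta> \<theta> M x u \<sigma> (\<alpha>, z, v)"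
    and par: "0 < \<sigma>" "0 < \<delta>" "0 < \<theta>" "\<theta> < 1" "0 < \<epsilon>"
    and L: "norm (T x) + \<sigma> * M \<le> L" "0 < L"
    and osc: "\<And>w. w \<in> C \<Longrightarrow> norm (w - x) < \<eta> \<Longrightarrow> norm (w - x) \<le> \<sigma> * L \<Longrightarrow>
                norm (T w - T x) \<le> \<delta> * \<epsilon> / 2"
    and c: "0 < c" "c \<le> \<sigma>" "c * L < \<theta> * \<eta>" "c * L \<le> \<theta> * \<epsilon>" "4 * c * M \<le> \<theta> * \<delta> * \<epsilon>"
    and z: "norm (x - z) \<le> \<epsilon>" "norm (x - z) \<le> c * \<epsilon>"
  shows "\<exists>\<beta> w. 0 < \<beta> \<and> \<beta> \<le> \<sigma> \<and> w = trial_point T C x u \<beta> \<and>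
           norm (x - w) \<le> \<epsilon> \<and> norm (x - w) \<le> \<epsilon> * \<beta>"
proof (cases "c \<le> \<alpha>")
  case True
  have "norm (x - z) \<le> \<epsilon> * \<alpha>"
    using z(2) mult_left_mono[OF True less_imp_le[OF par(5)]] by (simp add: mult.commute)
  then show ?thesis
    using linesearch_loop_output[OF ls] par z(1) by blast
next
  case False
  \<comment> \<open>Since \<open>\<alpha> < c \<le> \<sigma>\<close>, at least one trial was
    rejected.\<close>
  have pos: "0 < \<alpha>" and "\<alpha> \<noteq> \<sigma>"
    using linesearch_loop_output[OF ls] par False c(2) by auto
  then obtain \<gamma> w v' where g: "\<alpha> = \<theta> * \<gamma>" "\<gamma> \<le> \<sigma>" and w: "w = trial_point T C x u \<gamma>"
    and v': "norm v' \<le> M"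
    and rej: "\<delta> * norm (w - x) < \<gamma> * norm (T w - T x + \<gamma> *\<^sub>R v' - \<gamma> *\<^sub>R u)"
    using linesearch_loop_output[OF ls] par by blast
  have g0: "0 < \<gamma>" using pos g(1) par by (simp add: zero_less_mult_iff)
  have gc: "\<theta> * \<gamma> < c" using False g(1) by simp
  have M: "0 \<le> M" using u norm_ge_zero order_trans by blast
  have "norm (T x + \<gamma> *\<^sub>R u) \<le> norm (T x) + \<gamma> * norm u"
    using norm_triangle_ineq[of "T x" "\<gamma> *\<^sub>R u"] g0 by simp
  also have "\<dots> \<le> L"
    using mult_mono[OF g(2) u] par L by simp
  finally have "norm (x - w) \<le> \<gamma> * L"
    using norm_diff_trial_point_le[OF C x, of \<gamma> T u] g0 unfolding w
    by (meson less_imp_le mult_left_mono order_trans)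
  then have wx: "norm (w - x) \<le> \<gamma> * L" by (simp add: norm_minus_commute)
  \<comment> \<open>The bounds on \<open>c\<close> carry a factor \<open>\<theta>\<close> because
    only \<open>\<theta> * \<gamma> < c\<close> is known; cancelling it gives bounds on
    \<open>\<gamma>\<close>.\<close>
  have gL: "\<theta> * (\<gamma> * L) < c * L"
    using mult_strict_right_mono[OF gc L(2)] by (simp add: mult.assoc)
  have "\<theta> * (\<gamma> * L) < \<theta> * \<eta>" "\<theta> * (\<gamma> * L) < \<theta> * \<epsilon>"
    using gL c by linarith+
  then have small: "\<gamma> * L < \<eta>" "\<gamma> * L < \<epsilon>"
    using par by auto
  have "\<theta> * (4 * \<gamma> * M) \<le> \<theta> * (\<delta> * \<epsilon>)"
    using mult_right_mono[OF less_imp_le[OF gc] M] c(5) by (simp add: algebra_simps)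
  then have gM: "4 * \<gamma> * M \<le> \<delta> * \<epsilon>"
    using par by simp
  have wC: "w \<in> C" unfolding w by (rule trial_point_in[OF C x])
  have Tw: "norm (T w - T x) \<le> \<delta> * \<epsilon> / 2"
  proof (rule osc[OF wC])
    show "norm (w - x) \<le> \<sigma> * L"
      using wx mult_right_mono[OF g(2), of L] L by linarith
  qed (use wx small in linarith)
  \<comment> \<open>Half of \<open>\<delta> * \<epsilon>\<close> pays for the oscillation of
    \<open>T\<close>, a quarter for each normal vector.\<close>
  have "norm (T w - T x + \<gamma> *\<^sub>R v' - \<gamma> *\<^sub>R u) \<le> norm (T w - T x) + norm (\<gamma> *\<^sub>R v') + norm (\<gamma> *\<^sub>R u)"
    by (meson add_mono norm_triangle_ineq norm_triangle_ineq4 order_trans order_refl)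
  also have "\<dots> \<le> \<delta> * \<epsilon> / 2 + \<gamma> * M + \<gamma> * M"
    using Tw u v' g0 by (intro add_mono) auto
  also have "\<dots> \<le> \<delta> * \<epsilon>" using gM by (simp add: algebra_simps)
  finally have "\<delta> * norm (w - x) \<le> \<gamma> * (\<delta> * \<epsilon>)"
    using rej g0 by (meson less_imp_le mult_left_mono order_trans)
  then have "\<delta> * norm (w - x) \<le> \<delta> * (\<epsilon> * \<gamma>)" by (simp add: mult_ac)
  then have "norm (w - x) \<le> \<epsilon> * \<gamma>" using par by simp
  then show ?thesis
    using g0 g w wx small by (intro exI[of _ \<gamma>] exI[of _ w]) (auto simp: norm_minus_commute)
qed

section \<open>Convergence of the iterates\<close>

theorem proposition3p9:
  fixes T :: "real ^ 'n \<Rightarrow> real ^ 'n"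
    and C :: "(real ^ 'n) set"
    and \<sigma> \<delta> \<theta> M :: real
    and x :: "nat \<Rightarrow> real ^ 'n"
  assumes "C \<noteq> {}" and "closed C" and "convex C"
    and "\<sigma> > 0" and "0 < \<delta>" and "\<delta> < 1" and "0 < \<theta>" and "\<theta> < 1" and "M > 0"
    and "continuous_on C T"
    and "primal_sols T C \<noteq> {}"
    and "primal_sols T C \<subseteq> dual_sols T C"
    and "generated_by_B2 T C \<sigma> \<delta> \<theta> M x"
    and "\<forall>k. x k \<notin> primal_sols T C"
  shows "\<exists>s \<in> primal_sols T C. x \<longlonglongrightarrow> s"
proof -
  note C = assms(2,3)
  note ls_pos = assms(4,7,8)
  have "\<forall>k. \<exists>u \<alpha> z v. u \<in> normal_cone C (x k) \<and> norm u \<le> M \<and>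
       linesearch_loop T C \<delta> \<theta> M (x k) u \<sigma> (\<alpha>, z, v) \<and>
       x (Suc k) = closest_point (C \<inter> halfspace T z (\<alpha> *\<^sub>R v)) (x k)"
    using assms(13) unfolding generated_by_B2_def step_B2_def linesearch_B_def by blast
  then obtain u \<alpha> z v where u: "\<And>k. u k \<in> normal_cone C (x k)" "\<And>k. norm (u k) \<le> M"
    and ls: "\<And>k. linesearch_loop T C \<delta> \<theta> M (x k) (u k) \<sigma> (\<alpha> k, z k, v k)"
    and step: "\<And>k. x (Suc k) = closest_point (C \<inter> halfspace T (z k) (\<alpha> k *\<^sub>R v k)) (x k)"
    by metis
  define D where "D k = C \<inter> halfspace T (z k) (\<alpha> k *\<^sub>R v k)" for k
  have out: "0 < \<alpha> k" "\<alpha> k \<le> \<sigma>" "z k = trial_point T C (x k) (u k) (\<alpha> k)"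
    "v k \<in> normal_cone C (z k)" "norm (v k) \<le> M"
    "\<alpha> k * norm (T (z k) - T (x k) + \<alpha> k *\<^sub>R v k - \<alpha> k *\<^sub>R u k) \<le> \<delta> * norm (z k - x k)" for k
    using linesearch_loop_output[OF ls ls_pos refl] by metis+
  have D: "closed (D k)" "convex (D k)" for k
    unfolding D_def using C by (auto intro: closed_halfspace convex_halfspace convex_Int)
  have zC: "z k \<in> C" for k
    unfolding out(3)[of k] trial_point_def using C assms(1) closest_point_in_set by blast
  have SD: "s \<in> D k" if "s \<in> primal_sols T C" for s k
    using that assms(12) dual_sols_in_halfspace[OF _ zC out(4) less_imp_le[OF out(1)]]
    unfolding D_def dual_sols_def by blast
  obtain s where s: "s \<in> primal_sols T C" using assms(11) by blast
  have xD: "x (Suc k) \<in> D k" for k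
    unfolding step D_def[symmetric] using closest_point_in_set[OF D(1)] SD[OF s] by blast
  have xC: "x k \<in> C" for k
    using assms(13) xD[of "k - 1"] by (cases k) (auto simp: D_def generated_by_B2_def)
  have Fejer: "(norm (x (Suc k) - x k))\<^sup>2 \<le> (norm (x k - t))\<^sup>2 - (norm (x (Suc k) - t))\<^sup>2"
    if "t \<in> primal_sols T C" for t k
    using closest_point_Fejer[OF D SD[OF that]] unfolding step D_def[symmetric] by blast
  have mono: "dist (x (Suc k)) t \<le> dist (x k) t" if "t \<in> primal_sols T C" for t k
  proof -
    have "(norm (x (Suc k) - t))\<^sup>2 \<le> (norm (x k - t))\<^sup>2"
      using Fejer[OF that, of k] zero_le_power2[of "norm (x (Suc k) - x k)"] by linarith
    then show ?thesis by (simp add: dist_norm power2_le_iff_abs_le)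
  qed
  define R where "R = dist (x 0) s"
  have dec: "decseq (\<lambda>k. dist (x k) s)"
    using mono[OF s] by (simp add: decseq_SucI)
  have xR: "dist (x k) s \<le> R" for k
    using decseqD[OF dec, of 0 k] by (simp add: R_def)

  have bounded_T: "\<exists>B>0. \<forall>y\<in>C \<inter> cball s \<rho>. norm (T y) \<le> B" for \<rho>
  proof -
    have "compact (C \<inter> cball s \<rho>)" using C by (simp add: closed_Int_compact)
    then have "bounded (T ` (C \<inter> cball s \<rho>))"
      using assms(10) by (meson compact_continuous_image compact_imp_bounded continuous_on_subset inf_le1)
    then show ?thesis unfolding bounded_pos by blast
  qed
  obtain B1 where B1: "0 < B1" "\<And>y. y \<in> C \<inter> cball s R \<Longrightarrow> norm (T y) \<le> B1"
    using bounded_T by blast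
  define L where "L = B1 + \<sigma> * M"
  have L: "0 < L" using B1 assms by (simp add: L_def add_pos_pos)
  have Tx: "norm (T (x k)) \<le> B1" for k
    using B1(2)[of "x k"] xC xR by (simp add: dist_commute)
  have TL: "norm (T (x k)) + \<sigma> * M \<le> L" for k
    using Tx by (simp add: L_def)
  \<comment> \<open>Steps are at most \<open>\<sigma>\<close> and directions at most
    \<open>L\<close> in norm, so this one compact set holds all iterates and all their trial
    points.\<close>
  define K where "K = C \<inter> cball s (R + \<sigma> * L)"
  have K: "compact K" unfolding K_def using C by (simp add: closed_Int_compact)
  have inK: "w \<in> K" if "w \<in> C" "norm (w - x k) \<le> \<sigma> * L" for w k
  proof -
    have "dist w s \<le> dist w (x k) + dist (x k) s" by (rule dist_triangle)
    with that xR[of k] show ?thesis by (simp add: K_def dist_norm norm_minus_commute)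
  qed
  have xK: "x k \<in> K" for k
    using inK[of "x k" k] xC L assms by simp
  have zx: "norm (z k - x k) \<le> \<sigma> * L" for k
  proof -
    have "norm (T (x k) + \<alpha> k *\<^sub>R u k) \<le> norm (T (x k)) + \<alpha> k * norm (u k)"
      using norm_triangle_ineq[of "T (x k)" "\<alpha> k *\<^sub>R u k"] out(1)[of k] by simp
    also have "\<dots> \<le> L"
      using mult_mono[OF out(2) u(2), of k k] assms TL[of k] by simp
    finally have "\<alpha> k * norm (T (x k) + \<alpha> k *\<^sub>R u k) \<le> \<sigma> * L"
      using out(1,2)[of k] assms by (intro mult_mono) auto
    moreover have "norm (x k - z k) \<le> \<alpha> k * norm (T (x k) + \<alpha> k *\<^sub>R u k)"
      using norm_diff_trial_point_le[OF C xC less_imp_le[OF out(1)]] out(3) by metis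
    ultimately show ?thesis by (simp add: norm_minus_commute)
  qed
  obtain B2 where B2: "0 < B2" "\<And>y. y \<in> K \<Longrightarrow> norm (T y) \<le> B2"
    using bounded_T unfolding K_def by blast

  have xx_lim: "(\<lambda>k. norm (x k - x (Suc k))) \<longlonglongrightarrow> 0"
  proof -
    obtain d where "(\<lambda>k. dist (x k) s) \<longlonglongrightarrow> d"
      using decseq_convergent[OF dec, of 0] by auto
    then have d: "(\<lambda>k. norm (x k - s)) \<longlonglongrightarrow> d" by (simp add: dist_norm)
    \<comment> \<open>The distances to \<open>s\<close> converge, so the upper bound in
      \<open>Fejer\<close> vanishes in the limit.\<close>
    have lim: "(\<lambda>k. (norm (x k - s))\<^sup>2 - (norm (x (Suc k) - s))\<^sup>2) \<longlonglongrightarrow> d\<^sup>2 - d\<^sup>2"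
      by (intro tendsto_intros d LIMSEQ_Suc[OF d])
    have "(\<lambda>k. (norm (x (Suc k) - x k))\<^sup>2) \<longlonglongrightarrow> d\<^sup>2 - d\<^sup>2"
    proof (rule tendsto_sandwich[OF _ _ _ lim])
      show "(\<lambda>_. 0) \<longlonglongrightarrow> d\<^sup>2 - d\<^sup>2" by simp
    qed (use Fejer[OF s] in \<open>auto intro: always_eventually\<close>)
    then have "(\<lambda>k. norm (x (Suc k) - x k)) \<longlonglongrightarrow> 0"
      by (simp add: power_tendsto_0_iff)
    then show ?thesis
      by (simp only: norm_minus_commute)
  qed
  have xz_lim: "(\<lambda>k. norm (x k - z k)) \<longlonglongrightarrow> 0"
  proof -
    define Q where "Q = \<sigma> * (B2 + \<sigma> * M) / (1 - \<delta>)"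
    have "(norm (x k - z k))\<^sup>2 \<le> Q * norm (x k - x (Suc k))" for k
    proof -
      let ?g = "T (z k) + \<alpha> k *\<^sub>R v k"
      have "norm ?g \<le> norm (T (z k)) + \<alpha> k * norm (v k)"
        using norm_triangle_ineq[of "T (z k)" "\<alpha> k *\<^sub>R v k"] out(1)[of k] by simp
      also have "\<dots> \<le> B2 + \<sigma> * M"
        using B2(2)[OF inK[OF zC zx]] out(2)[of k] out(5)[of k] assms
        by (intro add_mono mult_mono) auto
      finally have g: "norm ?g \<le> B2 + \<sigma> * M" .
      \<comment> \<open>Membership of the next iterate in the half-space allows \<open>z k\<close>
        to be exchanged for \<open>x (Suc k)\<close>, which bounds the separation margin by the step
        length.\<close>
      have "inner ?g (x (Suc k) - z k) \<le> 0"
        using xD[of k] by (simp add: D_def halfspace_def)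
      then have "inner ?g (x k - z k) \<le> inner ?g (x k - x (Suc k))"
        by (simp add: inner_diff_right)
      also have "\<dots> \<le> norm ?g * norm (x k - x (Suc k))"
        by (rule norm_cauchy_schwarz)
      also have "\<dots> \<le> (B2 + \<sigma> * M) * norm (x k - x (Suc k))"
        using g by (intro mult_right_mono) auto
      finally have i: "inner ?g (x k - z k) \<le> (B2 + \<sigma> * M) * norm (x k - x (Suc k))" .
      have "(1 - \<delta>) * (norm (x k - z k))\<^sup>2 \<le> \<alpha> k * inner ?g (x k - z k)"
        by (rule accepted_step_separates[OF C xC out(3) out(1) out(6)])
      also have "\<dots> \<le> \<alpha> k * ((B2 + \<sigma> * M) * norm (x k - x (Suc k)))"
        using i out(1)[of k] by simp
      also have "\<dots> \<le> \<sigma> * ((B2 + \<sigma> * M) * norm (x k - x (Suc k)))"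
        using out(2) B2 assms by (intro mult_right_mono) auto
      finally show ?thesis
        using assms by (simp add: Q_def field_simps)
    qed
    then have "(\<lambda>k. (norm (x k - z k))\<^sup>2) \<longlonglongrightarrow> 0"
      by (intro tendsto_sandwich[OF _ _ tendsto_const tendsto_mult_right_zero[OF xx_lim]])
        (auto intro: always_eventually)
    then show ?thesis by (simp add: power_tendsto_0_iff)
  qed

  have residual: "\<forall>\<^sub>F k in sequentially. \<exists>\<beta> w. 0 < \<beta> \<and> \<beta> \<le> \<sigma> \<and>
      w = trial_point T C (x k) (u k) \<beta> \<and> norm (x k - w) \<le> \<epsilon> \<and> norm (x k - w) \<le> \<epsilon> * \<beta>"
    if "0 < \<epsilon>" for \<epsilon>
  proof -
    have "uniformly_continuous_on K T"
      using K assms(10) by (intro compact_uniformly_continuous continuous_on_subset[OF assms(10)])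
        (auto simp: K_def)
    moreover have "0 < \<delta> * \<epsilon> / 2" using that assms by simp
    ultimately obtain \<eta> where \<eta>: "0 < \<eta>"
      "\<And>y y'. y \<in> K \<Longrightarrow> y' \<in> K \<Longrightarrow> dist y' y < \<eta> \<Longrightarrow> dist (T y') (T y) < \<delta> * \<epsilon> / 2"
      unfolding uniformly_continuous_on_def by metis
    have osc: "norm (T w - T (x k)) \<le> \<delta> * \<epsilon> / 2"
      if "w \<in> C" "norm (w - x k) < \<eta>" "norm (w - x k) \<le> \<sigma> * L" for w k
      using \<eta>(2)[OF xK inK[OF that(1,3)]] that(2) by (simp add: dist_norm less_imp_le)
    \<comment> \<open>One entry for each upper bound on \<open>c\<close> in
      \<open>linesearch_small_residual\<close>; the 2 makes the bound with \<open>\<eta>\<close>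
      strict.\<close>
    define c where "c = Min {\<sigma>, \<theta> * \<eta> / (2 * L), \<theta> * \<epsilon> / L, \<theta> * \<delta> * \<epsilon> / (4 * M)}"
    have "0 < c" unfolding c_def using assms L \<eta>(1) that by simp
    have c': "c \<le> \<sigma>" "c \<le> \<theta> * \<eta> / (2 * L)" "c \<le> \<theta> * \<epsilon> / L" "c \<le> \<theta> * \<delta> * \<epsilon> / (4 * M)"
      unfolding c_def by (auto intro!: Min_le)
    have "2 * (c * L) \<le> \<theta> * \<eta>" "c * L \<le> \<theta> * \<epsilon>" "4 * c * M \<le> \<theta> * \<delta> * \<epsilon>"
      using c' L assms by (simp_all add: pos_le_divide_eq mult_ac)
    moreover have "0 < c * L" using \<open>0 < c\<close> L by simp
    ultimately have c: "0 < c" "c \<le> \<sigma>" "c * L < \<theta> * \<eta>" "c * L \<le> \<theta> * \<epsilon>"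
      "4 * c * M \<le> \<theta> * \<delta> * \<epsilon>"
      using \<open>0 < c\<close> c'(1) by linarith+
    have "0 < c * \<epsilon>" using c(1) that by simp
    then have "\<forall>\<^sub>F k in sequentially. norm (x k - z k) < \<epsilon> \<and> norm (x k - z k) < c * \<epsilon>"
      using order_tendstoD(2)[OF xz_lim] that by (simp add: eventually_conj)
    then show ?thesis
    proof (rule eventually_mono)
      fix k assume "norm (x k - z k) < \<epsilon> \<and> norm (x k - z k) < c * \<epsilon>"
      then show "\<exists>\<beta> w. 0 < \<beta> \<and> \<beta> \<le> \<sigma> \<and> w = trial_point T C (x k) (u k) \<beta> \<and>
          norm (x k - w) \<le> \<epsilon> \<and> norm (x k - w) \<le> \<epsilon> * \<beta>"
        using linesearch_small_residual[OF C xC u(2) ls assms(4,5,7,8) that TL L osc c] by simp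
    qed
  qed

  have asym: "\<forall>\<^sub>F k in sequentially. - \<epsilon> \<le> inner (T (x k)) (y - x k)"
    if y: "y \<in> C" and "0 < \<epsilon>" for y \<epsilon>
  proof -
    \<comment> \<open>\<open>W\<close> adds the factors of \<open>e\<close> in the two error terms:
      \<open>norm (y - w)\<close> is at most \<open>norm (y - s) + R + 1\<close>, using
      \<open>e \<le> 1\<close>, and \<open>L\<close> bounds the other coefficient.\<close>
    define W where "W = norm (y - s) + R + 1 + L"
    have W: "1 \<le> W" using L by (simp add: W_def R_def)
    define e where "e = min 1 (\<epsilon> / W)"
    have e: "0 < e" "e \<le> 1" "e * W \<le> \<epsilon>"
      using W \<open>0 < \<epsilon>\<close> by (auto simp: e_def min_def field_simps)
    show ?thesis
    proof (rule eventually_mono[OF residual[OF e(1)]], elim exE conjE)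
      fix k \<beta> w
      assume b: "0 < \<beta>" "\<beta> \<le> \<sigma>" and w: "w = trial_point T C (x k) (u k) \<beta>"
        and small: "norm (x k - w) \<le> e" "norm (x k - w) \<le> e * \<beta>"
      have "norm (y - w) \<le> norm (y - s) + norm (x k - s) + norm (x k - w)"
        using norm_triangle_ineq[of "y - s" "s - x k"] norm_triangle_ineq[of "y - x k" "x k - w"]
        by (simp add: norm_minus_commute)
      then have yw: "norm (y - w) \<le> norm (y - s) + R + 1"
        using xR[of k] small e by (simp add: dist_norm)
      have "norm (T (x k)) + \<beta> * M \<le> L"
        using TL[of k] mult_right_mono[OF b(2) less_imp_le[OF assms(9)]] by linarith
      then have "(norm (T (x k)) + \<beta> * M) * norm (x k - w) \<le> L * e"
        using small L by (intro mult_mono) auto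
      moreover have "e * norm (y - w) \<le> e * (norm (y - s) + R + 1)"
        using yw e by simp
      ultimately have "e * norm (y - w) + (norm (T (x k)) + \<beta> * M) * norm (x k - w) \<le> \<epsilon>"
        using e(3) by (simp add: W_def algebra_simps)
      then show "- \<epsilon> \<le> inner (T (x k)) (y - x k)"
        using inner_ge_of_residual[OF C y w b(1) u(1) u(2) small(2)] by simp
    qed
  qed
  show ?thesis
  proof (rule Fejer_monotone_LIMSEQ)
    show "l \<in> primal_sols T C" if "strict_mono r" "(x \<circ> r) \<longlonglongrightarrow> l" for r l
      by (rule cluster_point_primal_sol[OF C(1) assms(10) xC asym that])
  qed (use assms(11) mono in auto)
qed

end
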